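(* Let $\epsilon\in(0,1]$ and $l=1/\epsilon$. For $v\in H^1_0(\Gamma'_{\rm in})$, where $\Gamma'_{\rm in}=\{0\}\times(0,1)$, define $\tilde v$ on $\partial\Pi'_{l}$ by $$\tilde v\Big(\frac1\epsilon,\frac{x_2}{\epsilon}\Big)=v(0,x_2)\quad\forall x_2\in[0,1],$$ extended by zero to the rest of $\partial\Pi'_{l}$. Then $$\|\tilde v\|_{W^{1,2}_{1/2}(\partial\Pi'_l)}\le k\,\|v\|_{H^1_0(\Gamma'_{\rm in})}\le k'\,\|\tilde v\|_{W^{1,2}_{1/2}(\partial\Pi'_l)},$$ where the constants $k,k'$ do not depend on $\epsilon$.
   Context: $\Pi'_l=(l,\infty)\times(0,\infty)$ and $\partial\Pi'_l=(\{l\}\times(0,\infty))\cup((l,\infty)\times\{0\})$. $W^{1,2}_{1/2}(\partial\Pi'_l)$ is the weighted space with norm squared $\int_{\partial\Pi'_l}\{(1+\rho^2)^{-1/2}g^2+(1+\rho^2)^{1/2}(g')^2\}d\sigma$, where $\rho$ is the distance to the origin and $g'$ the tangential derivative. *)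

theory Defs
  imports "HOL-Analysis.Analysis"
begin

definition smooth :: "(real \<Rightarrow> real) \<Rightarrow> bool" where
  "smooth \<phi> \<longleftrightarrow> (\<forall>k x. ((deriv ^^ k) \<phi>) differentiable (at x))"

definition test_function :: "real set \<Rightarrow> (real \<Rightarrow> real) \<Rightarrow> bool" where
  "test_function S \<phi> \<longleftrightarrow>
     smooth \<phi> \<and> compact (closure {s. \<phi> s \<noteq> 0}) \<and> closure {s. \<phi> s \<noteq> 0} \<subseteq> S"

definition locally_integrable :: "real set \<Rightarrow> (real \<Rightarrow> real) \<Rightarrow> bool" where
  "locally_integrable S f \<longleftrightarrow>
     (\<forall>K. compact K \<and> K \<subseteq> S \<longrightarrow> set_integrable lborel K f)"

text \<open>\<open>h\<close> is the distributional derivative of \<open>f\<close> on the open set \<open>S\<close>.\<close>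

definition weak_deriv :: "real set \<Rightarrow> (real \<Rightarrow> real) \<Rightarrow> (real \<Rightarrow> real) \<Rightarrow> bool" where
  "weak_deriv S f h \<longleftrightarrow>
     locally_integrable S f \<and> locally_integrable S h \<and>
     (\<forall>\<phi>. test_function S \<phi> \<longrightarrow>
        (LINT s:S|lborel. f s * deriv \<phi> s) = - (LINT s:S|lborel. h s * \<phi> s))"

text \<open>
  Sobolev spaces on a plane curve.  A curve is given by a set of points \<open>C\<close> together with an
  injective arc-length parametrization \<open>\<gamma>\<close> on an open interval \<open>S\<close>, whose image agrees with \<open>C\<close>
  up to finitely many points (for the boundary of the quarter plane, up to the corner).
  Functions on the curve are functions on the plane of which only the values on \<open>C\<close> matter,
  up to equality almost everywhere with respect to arc length; so the ``norms'' below are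
  seminorms on representatives.
\<close>

definition arc_measure :: "(real \<Rightarrow> real \<times> real) \<Rightarrow> real set \<Rightarrow> (real \<times> real) measure" where
  "arc_measure \<gamma> S = distr (restrict_space lborel S) borel \<gamma>"

definition is_tangential_deriv ::
  "(real \<Rightarrow> real \<times> real) \<Rightarrow> real set \<Rightarrow> (real \<times> real \<Rightarrow> real) \<Rightarrow> (real \<times> real \<Rightarrow> real) \<Rightarrow> bool" where
  "is_tangential_deriv \<gamma> S g h \<longleftrightarrow> weak_deriv S (g \<circ> \<gamma>) (h \<circ> \<gamma>)"

text \<open>The choice is immaterial, weak derivatives being unique almost everywhere.\<close>

definition tangential_deriv ::
  "(real \<Rightarrow> real \<times> real) \<Rightarrow> real set \<Rightarrow> (real \<times> real \<Rightarrow> real) \<Rightarrow> real \<times> real \<Rightarrow> real" where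
  "tangential_deriv \<gamma> S g = (SOME h. is_tangential_deriv \<gamma> S g h)"

definition sobolev_space ::
  "(real \<Rightarrow> real \<times> real) \<Rightarrow> real set \<Rightarrow> (real \<times> real) set \<Rightarrow>
   (real \<times> real \<Rightarrow> real) \<Rightarrow> (real \<times> real \<Rightarrow> real) \<Rightarrow> (real \<times> real \<Rightarrow> real) set" where
  "sobolev_space \<gamma> S C w\<^sub>0 w\<^sub>1 =
     {g. \<exists>h. is_tangential_deriv \<gamma> S g h \<and>
        set_integrable (arc_measure \<gamma> S) C (\<lambda>x. w\<^sub>0 x * (g x)\<^sup>2) \<and>
        set_integrable (arc_measure \<gamma> S) C (\<lambda>x. w\<^sub>1 x * (h x)\<^sup>2)}"

definition sobolev_norm ::
  "(real \<Rightarrow> real \<times> real) \<Rightarrow> real set \<Rightarrow> (real \<times> real) set \<Rightarrow>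
   (real \<times> real \<Rightarrow> real) \<Rightarrow> (real \<times> real \<Rightarrow> real) \<Rightarrow> (real \<times> real \<Rightarrow> real) \<Rightarrow> real" where
  "sobolev_norm \<gamma> S C w\<^sub>0 w\<^sub>1 g =
     sqrt (LINT x:C|arc_measure \<gamma> S.
       w\<^sub>0 x * (g x)\<^sup>2 + w\<^sub>1 x * (tangential_deriv \<gamma> S g x)\<^sup>2)"

definition Gamma_in :: "(real \<times> real) set" where
  "Gamma_in = {0} \<times> {0<..<1}"

definition gamma_in :: "real \<Rightarrow> real \<times> real" where
  "gamma_in s = (0, s)"

definition H1_in :: "(real \<times> real \<Rightarrow> real) set" where
  "H1_in = sobolev_space gamma_in {0<..<1} Gamma_in (\<lambda>_. 1) (\<lambda>_. 1)"

definition H1_in_norm :: "(real \<times> real \<Rightarrow> real) \<Rightarrow> real" where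
  "H1_in_norm = sobolev_norm gamma_in {0<..<1} Gamma_in (\<lambda>_. 1) (\<lambda>_. 1)"

text \<open>The closure of the test functions in \<open>H\<^sup>1\<close>, with the full \<open>H\<^sup>1\<close> norm.\<close>

definition H10_in :: "(real \<times> real \<Rightarrow> real) set" where
  "H10_in = {v \<in> H1_in. \<exists>\<phi> :: nat \<Rightarrow> real \<times> real \<Rightarrow> real.
     (\<forall>n. test_function {0<..<1} (\<phi> n \<circ> gamma_in)) \<and>
     (\<lambda>n. H1_in_norm (\<lambda>x. v x - \<phi> n x)) \<longlonglongrightarrow> 0}"

abbreviation H10_in_norm :: "(real \<times> real \<Rightarrow> real) \<Rightarrow> real" where
  "H10_in_norm \<equiv> H1_in_norm"

definition quarter_bdry :: "real \<Rightarrow> (real \<times> real) set" where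
  "quarter_bdry l = ({l} \<times> {0<..}) \<union> ({l<..} \<times> {0})"

text \<open>
  The vertical half-line corresponds to \<open>s > 0\<close>, the horizontal one to \<open>s < 0\<close>, the corner to
  \<open>s = 0\<close>.  Taking weak derivatives in \<open>s\<close> over all of \<open>\<real>\<close> rules out jumps at the corner.
\<close>

definition quarter_arc :: "real \<Rightarrow> real \<Rightarrow> real \<times> real" where
  "quarter_arc l s = (if 0 \<le> s then (l, s) else (l - s, 0))"

lemma range_quarter_arc: "range (quarter_arc l) = insert (l, 0) (quarter_bdry l)"
proof
  show "range (quarter_arc l) \<subseteq> insert (l, 0) (quarter_bdry l)"
    by (auto simp: quarter_arc_def quarter_bdry_def)
  show "insert (l, 0) (quarter_bdry l) \<subseteq> range (quarter_arc l)"
  proof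
    fix p assume "p \<in> insert (l, 0) (quarter_bdry l)"
    then have "p = quarter_arc l (snd p - (fst p - l))"
      by (auto simp: quarter_arc_def quarter_bdry_def)
    then show "p \<in> range (quarter_arc l)" by blast
  qed
qed

text \<open>On \<^typ>\<open>real \<times> real\<close> the norm is Euclidean, so \<^term>\<open>norm x\<close> is the distance to the origin.\<close>

definition W_half :: "real \<Rightarrow> (real \<times> real \<Rightarrow> real) set" where
  "W_half l = sobolev_space (quarter_arc l) UNIV (quarter_bdry l)
     (\<lambda>x. (1 + (norm x)\<^sup>2) powr (- 1 / 2)) (\<lambda>x. (1 + (norm x)\<^sup>2) powr (1 / 2))"

definition W_half_norm :: "real \<Rightarrow> (real \<times> real \<Rightarrow> real) \<Rightarrow> real" where
  "W_half_norm l = sobolev_norm (quarter_arc l) UNIV (quarter_bdry l)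
     (\<lambda>x. (1 + (norm x)\<^sup>2) powr (- 1 / 2)) (\<lambda>x. (1 + (norm x)\<^sup>2) powr (1 / 2))"

definition extend :: "real \<Rightarrow> (real \<times> real \<Rightarrow> real) \<Rightarrow> real \<times> real \<Rightarrow> real" where
  "extend \<epsilon> v x =
     (if fst x = 1 / \<epsilon> \<and> 0 \<le> snd x \<and> snd x \<le> 1 / \<epsilon> then v (0, \<epsilon> * snd x) else 0)"

lemma extend_on_segment:
  "0 < \<epsilon> \<Longrightarrow> 0 \<le> x\<^sub>2 \<Longrightarrow> x\<^sub>2 \<le> 1 \<Longrightarrow> extend \<epsilon> v (1 / \<epsilon>, x\<^sub>2 / \<epsilon>) = v (0, x\<^sub>2)"
  by (simp add: extend_def divide_right_mono)

end

theory Submission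
  imports Defs
begin

text \<open>
  After the substitution \<open>s = t / \<epsilon>\<close>, the squared norm of the extension is the integral over \<open>(0, 1)\<close>
  of \<open>(l / r) v\<^sup>2 + (r / l) v'\<^sup>2\<close> with \<open>r = (1 + l\<^sup>2 + l\<^sup>2 t\<^sup>2)\<^sup>1\<^sup>/\<^sup>2\<close>, and \<open>l \<le> r \<le> 2 l\<close> because \<open>l \<ge> 1\<close>; so
  both weights lie between \<open>1/2\<close> and \<open>2\<close>.  The extension by zero has no jumps, since integration by
  parts on \<open>(0, 1)\<close> has no boundary terms for limits of test functions, against any \<open>C\<^sup>1\<close> function.
  As the norms refer to an arbitrary choice of weak derivative, uniqueness of weak derivatives is
  needed to evaluate them.
\<close>

subsection \<open>Smooth bump functions\<close>

text \<open>The zero extension of \<open>v\<close> is tested against functions \<phi> on the whole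
  line. Pulled back to (0, 1), such a \<phi> becomes \<open>\<phi> (l * t)\<close>, which need not
  vanish at 0 and 1 and so need not be a test function there. The weak derivative of
  \<open>v\<close> on (0, 1) alone therefore does not suffice; for the constant function 1 the
  extension does jump. Membership in the closure of the test functions has to be used. Neither
  traces nor continuous representatives enter: the pairing of \<open>v\<close> and its weak
  derivative with \<psi>' and \<psi> is continuous in the H1 norm of \<open>v\<close> and vanishes
  on test functions. The weights match the dilation by l exactly. Arc length gains a factor l and
  the derivative a factor 1 / l, while (1 + |x|^2)^(1/2) is comparable to l on the segment that
  carries the extension; the powers of l cancel in both terms, so the constants do not see
  \<epsilon>. Uniqueness of weak derivatives requires a supply of test functions, and
  \<open>smooth\<close> speaks of all iterated derivatives, so explicit ones are built from exp (-1
  / x).\<close>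

inductive lin_span :: "((real \<Rightarrow> real) \<Rightarrow> bool) \<Rightarrow> (real \<Rightarrow> real) \<Rightarrow> bool" for P where
  base: "P f \<Longrightarrow> lin_span P f"
| add: "lin_span P f \<Longrightarrow> lin_span P g \<Longrightarrow> lin_span P (\<lambda>x. f x + g x)"
| scale: "lin_span P f \<Longrightarrow> lin_span P (\<lambda>x. c * f x)"

text \<open>Iterated derivatives rarely have a manageable closed form. If each member of a class has
  its derivative in the linear span of the class, then the span is closed under
  \<open>deriv\<close>, and every iterate stays inside it.\<close>

lemma smooth_lin_spanI:
  assumes P: "\<And>f. P f \<Longrightarrow> \<exists>f'. (\<forall>x. (f has_real_derivative f' x) (at x)) \<and> lin_span P f'"
    and f: "lin_span P f"
  shows "smooth f"
proof -
  have step: "\<exists>f'. (\<forall>x. (f has_real_derivative f' x) (at x)) \<and> lin_span P f'" if "lin_span P f" for f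
    using that
  proof induction
    case (base f)
    then show ?case by (rule P)
  next
    case (add f g)
    then obtain f' g' where "\<forall>x. (f has_real_derivative f' x) (at x)" "lin_span P f'"
      "\<forall>x. (g has_real_derivative g' x) (at x)" "lin_span P g'" by auto
    then show ?case
      by (intro exI[of _ "\<lambda>x. f' x + g' x"]) (auto intro!: derivative_eq_intros lin_span.add)
  next
    case (scale f c)
    then obtain f' where "\<forall>x. (f has_real_derivative f' x) (at x)" "lin_span P f'" by auto
    then show ?case
      by (intro exI[of _ "\<lambda>x. c * f' x"]) (auto intro!: DERIV_cmult lin_span.scale)
  qed
  have iter: "lin_span P ((deriv ^^ k) f)" for k
  proof (induction k)
    case (Suc k)
    obtain f' where f': "\<forall>x. ((deriv ^^ k) f has_real_derivative f' x) (at x)" "lin_span P f'"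
      using step[OF Suc] by auto
    then have "deriv ((deriv ^^ k) f) = f'"
      by (intro ext DERIV_imp_deriv) auto
    then show ?case using f' by simp
  qed (use f in simp)
  show ?thesis
    unfolding smooth_def using step[OF iter] by (meson real_differentiable_def)
qed

lemma smooth_imp_DERIV: "smooth f \<Longrightarrow> (f has_real_derivative deriv f x) (at x)"
  unfolding smooth_def by (metis DERIV_deriv_iff_real_differentiable funpow_0)

lemma smooth_deriv: "smooth f \<Longrightarrow> smooth (deriv f)"
  unfolding smooth_def by (metis comp_apply funpow_Suc_right)

lemma smooth_imp_continuous: "smooth f \<Longrightarrow> continuous_on UNIV f"
  by (meson DERIV_isCont continuous_at_imp_continuous_on smooth_imp_DERIV)

lemma smooth_mult:
  assumes "smooth f" "smooth g"
  shows "smooth (\<lambda>x. f x * g x)"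
proof -
  let ?P = "\<lambda>h. \<exists>f g. smooth f \<and> smooth g \<and> h = (\<lambda>x. f x * g x)"
  show ?thesis
  proof (rule smooth_lin_spanI[where P = ?P])
    show "lin_span ?P (\<lambda>x. f x * g x)"
      using assms by (auto intro!: lin_span.base)
  next
    fix h assume "?P h"
    then obtain f g where h: "smooth f" "smooth g" "h = (\<lambda>x. f x * g x)" by blast
    have "lin_span ?P (\<lambda>x. deriv f x * g x + f x * deriv g x)"
      using h smooth_deriv by (intro lin_span.add lin_span.base) blast+
    moreover have "(h has_real_derivative deriv f x * g x + f x * deriv g x) (at x)" for x
      unfolding h using h smooth_imp_DERIV by (auto intro!: derivative_eq_intros)
    ultimately show "\<exists>f'. (\<forall>x. (h has_real_derivative f' x) (at x)) \<and> lin_span ?P f'"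
      by (intro exI[of _ "\<lambda>x. deriv f x * g x + f x * deriv g x"]) simp
  qed
qed

lemma smooth_compose_affine:
  assumes "smooth f"
  shows "smooth (\<lambda>x. f (a * x + b))"
proof -
  let ?P = "\<lambda>h. \<exists>f. smooth f \<and> h = (\<lambda>x. f (a * x + b))"
  show ?thesis
  proof (rule smooth_lin_spanI[where P = ?P])
    show "lin_span ?P (\<lambda>x. f (a * x + b))"
      using assms by (auto intro!: lin_span.base)
  next
    fix h assume "?P h"
    then obtain f where h: "smooth f" "h = (\<lambda>x. f (a * x + b))" by blast
    have "lin_span ?P (\<lambda>x. a * deriv f (a * x + b))"
      using h smooth_deriv by (intro lin_span.scale lin_span.base) blast+
    moreover have "(h has_real_derivative a * deriv f (a * x + b)) (at x)" for x
      unfolding h by (rule DERIV_cong, rule DERIV_chain2[where g = "\<lambda>x. a * x + b"], rule smooth_imp_DERIV)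
        (auto intro!: derivative_eq_intros h)
    ultimately show "\<exists>f'. (\<forall>x. (h has_real_derivative f' x) (at x)) \<and> lin_span ?P f'"
      by (intro exI[of _ "\<lambda>x. a * deriv f (a * x + b)"]) simp
  qed
qed

text \<open>The classical function exp (-1 / x), extended by zero, is the case \<open>k = 0\<close>.
  The powers of 1 / x are included because differentiation produces them, so that the family spans a
  space closed under \<open>deriv\<close>.\<close>

definition flat :: "nat \<Rightarrow> real \<Rightarrow> real" where
  "flat k x = (if 0 < x then inverse x ^ k * exp (- inverse x) else 0)"

lemma tendsto_flat_0: "(flat k \<longlongrightarrow> 0) (at 0)"
proof -
  have "((\<lambda>x::real. inverse x ^ k / exp (inverse x)) \<longlongrightarrow> 0) (at_right 0)"
    by (rule filterlim_compose[OF tendsto_power_div_exp_0 filterlim_inverse_at_top_right])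
  moreover have "\<forall>\<^sub>F x in at_right (0::real). inverse x ^ k / exp (inverse x) = flat k x"
    by (auto simp: eventually_at_filter flat_def exp_minus field_simps)
  ultimately have "(flat k \<longlongrightarrow> 0) (at_right 0)"
    using tendsto_cong by fastforce
  moreover have "(flat k \<longlongrightarrow> 0) (at_left 0)"
    by (rule tendsto_eventually) (auto simp: eventually_at_filter flat_def)
  ultimately show ?thesis by (simp add: filterlim_split_at)
qed

lemma DERIV_flat: "(flat k has_real_derivative flat (k + 2) x - real k * flat (k + 1) x) (at x)"
proof (cases x "0::real" rule: linorder_cases)
  case less
  have "(flat k has_real_derivative 0) (at x)"
    by (rule has_field_derivative_transform_within_open[of "\<lambda>_. 0" _ _ "{..<0}"])
      (use less in \<open>auto simp: flat_def\<close>)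
  then show ?thesis using less by (simp add: flat_def)
next
  case equal
  \<comment> \<open>The difference quotient of \<open>flat k\<close> at 0 is
    \<open>flat (k + 1)\<close> itself, so differentiability at 0 reduces to the limit already known
    for every exponent.\<close>
  have "((\<lambda>h. flat (k + 1) h) \<longlongrightarrow> 0) (at 0)" by (rule tendsto_flat_0)
  moreover have "flat (k + 1) h = (flat k (0 + h) - flat k 0) / h" if "h \<noteq> 0" for h
    using that by (auto simp: flat_def field_simps)
  ultimately have "((\<lambda>h. (flat k (0 + h) - flat k 0) / h) \<longlongrightarrow> 0) (at 0)"
    by (smt (verit) tendsto_cong eventually_at_filter eventuallyI)
  then show ?thesis unfolding equal DERIV_def by (simp add: flat_def)
next
  case greater
  have "((\<lambda>x. inverse x ^ k) has_real_derivative - real k * inverse x ^ (k + 1)) (at x)"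
    by (rule DERIV_cong, rule DERIV_power, rule DERIV_inverse, (use greater in simp), cases k)
      (simp_all add: algebra_simps power2_eq_square)
  from DERIV_mult[OF this, of "\<lambda>x. exp (- inverse x)" "exp (- inverse x) * inverse x ^ 2"]
  have "((\<lambda>x. inverse x ^ k * exp (- inverse x)) has_real_derivative
      inverse x ^ (k + 2) * exp (- inverse x) - real k * (inverse x ^ (k + 1) * exp (- inverse x))) (at x)"
    using greater
    by (elim meta_impE) (auto intro!: derivative_eq_intros elim!: DERIV_cong simp: algebra_simps power2_eq_square)
  then have "(flat k has_real_derivative
      inverse x ^ (k + 2) * exp (- inverse x) - real k * (inverse x ^ (k + 1) * exp (- inverse x))) (at x)"
    by (rule has_field_derivative_transform_within_open[where S = "{0<..}"])
      (use greater in \<open>auto simp: flat_def\<close>)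
  then show ?thesis using greater by (simp add: flat_def)
qed

lemma smooth_flat: "smooth (flat k)"
proof (rule smooth_lin_spanI[where P = "\<lambda>f. \<exists>k. f = flat k"])
  fix f assume "\<exists>k. f = flat k"
  then obtain k where f: "f = flat k" ..
  have "lin_span (\<lambda>f. \<exists>k. f = flat k) (\<lambda>x. flat (k + 2) x + (- real k) * flat (k + 1) x)"
    by (intro lin_span.add lin_span.scale lin_span.base) (auto simp del: One_nat_def add_Suc_right)
  then show "\<exists>f'. (\<forall>x. (f has_real_derivative f' x) (at x)) \<and> lin_span (\<lambda>f. \<exists>k. f = flat k) f'"
    unfolding f using DERIV_flat[of k]
    by (intro exI[of _ "\<lambda>x. flat (k + 2) x + (- real k) * flat (k + 1) x"]) simp
qed (auto intro: lin_span.base)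

lemma tendsto_flat_scaled: "(\<lambda>n. flat 0 (real n * x)) \<longlonglongrightarrow> (if 0 < x then 1 else 0)"
proof (cases "0 < x")
  case True
  have "(\<lambda>n. exp (- (inverse x * inverse (real n)))) \<longlonglongrightarrow> exp (- (inverse x * 0))"
    by (intro tendsto_intros lim_inverse_n)
  moreover have "\<forall>\<^sub>F n in sequentially. exp (- (inverse x * inverse (real n))) = flat 0 (real n * x)"
    using eventually_gt_at_top[of 0] by eventually_elim (use True in \<open>auto simp: flat_def\<close>)
  ultimately show ?thesis using True by (simp add: tendsto_cong)
next
  case False
  then have "flat 0 (real n * x) = 0" for n
    by (auto simp: flat_def zero_less_mult_iff)
  with False show ?thesis by simp
qed

lemma flat_0_bounds: "0 \<le> flat 0 x" "flat 0 x \<le> 1"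
  by (auto simp: flat_def)

text \<open>No cutoff is needed: dilating the argument of \<open>flat 0\<close> by \<open>n\<close> makes these test functions
  converge to the indicator of the interval.\<close>

definition bump :: "real \<Rightarrow> real \<Rightarrow> nat \<Rightarrow> real \<Rightarrow> real" where
  "bump a b n x = flat 0 (real n * (x - a)) * flat 0 (real n * (b - x))"

lemma bump_eq_0: "x \<notin> {a<..<b} \<Longrightarrow> bump a b n x = 0"
  by (auto simp: bump_def flat_def not_less mult_nonneg_nonpos zero_less_mult_iff)

lemma bump_bounds: "\<bar>bump a b n x\<bar> \<le> 1"
  unfolding bump_def abs_mult by (rule mult_le_one) (auto simp: flat_0_bounds abs_of_nonneg)

text \<open>The closed interval has to lie in \<open>S\<close>: the function vanishes off the open
  interval, but its support is a closure and may contain the endpoints.\<close>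

lemma test_function_bump:
  assumes "{a..b} \<subseteq> S"
  shows "test_function S (bump a b n)"
proof -
  have "{s. bump a b n s \<noteq> 0} \<subseteq> {a..b}"
  proof
    fix s assume "s \<in> {s. bump a b n s \<noteq> 0}"
    then have "s \<in> {a<..<b}" using bump_eq_0 by blast
    then show "s \<in> {a..b}" by simp
  qed
  then have "closure {s. bump a b n s \<noteq> 0} \<subseteq> {a..b}"
    by (rule closure_minimal) simp
  moreover from this have "compact (closure {s. bump a b n s \<noteq> 0})"
    by (meson bounded_closed_interval bounded_subset closed_closure compact_eq_bounded_closed)
  moreover have "smooth (bump a b n)"
    using smooth_mult[OF smooth_compose_affine[OF smooth_flat[of 0], of "real n" "- real n * a"]
        smooth_compose_affine[OF smooth_flat[of 0], of "- real n" "real n * b"]]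
    by (simp add: bump_def[abs_def] algebra_simps)
  ultimately show ?thesis
    using assms unfolding test_function_def by blast
qed

lemma tendsto_bump: "(\<lambda>n. bump a b n x) \<longlonglongrightarrow> indicator {a<..<b} x"
proof -
  have "(\<lambda>n. bump a b n x) \<longlonglongrightarrow> (if 0 < x - a then 1 else 0) * (if 0 < b - x then 1 else 0)"
    unfolding bump_def by (intro tendsto_mult tendsto_flat_scaled)
  then show ?thesis by (auto simp: indicator_def split: if_splits)
qed

subsection \<open>Uniqueness of weak derivatives\<close>

text \<open>The half-lines are an intersection-stable generator of the Borel sets, and the sets over
  which \<open>f\<close> integrates to 0 are closed under countable disjoint unions and, by
  \<open>tot\<close>, under complements. So the integral vanishes over every Borel set, and
  \<open>f\<close> has the same density as 0.\<close>

lemma AE_0_if_integral_atMost_0: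
  fixes f :: "real \<Rightarrow> real"
  assumes f: "integrable lborel f"
    and tot: "(LINT x|lborel. f x) = 0"
    and Iic: "\<And>c. (LINT x:{..c}|lborel. f x) = 0"
  shows "AE x in lborel. f x = 0"
proof (rule density_unique_real[OF f integrable_zero])
  fix A :: "real set" assume "A \<in> sets lborel"
  then have A: "A \<in> sigma_sets UNIV (range (\<lambda>a. {..a}))"
    by (simp add: borel_eq_atMost)
  have sets: "B \<in> sets lborel" if "B \<in> sigma_sets UNIV (range (\<lambda>a::real. {..a}))" for B
    using that by (simp add: borel_eq_atMost)
  have int: "set_integrable lborel B f" if "B \<in> sets lborel" for B
    unfolding set_integrable_def using that f by (rule integrable_mult_indicator)
  have "(LINT x:A|lborel. f x) = 0"
  proof (rule sigma_sets_induct_disjoint[OF _ _ A])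
    show "Int_stable (range (\<lambda>a::real. {..a}))"
    proof (rule Int_stableI)
      fix B C assume "B \<in> range (\<lambda>a::real. {..a})" "C \<in> range (\<lambda>a::real. {..a})"
      then obtain p q where "B = {..p}" "C = {..q}" by auto
      then have "B \<inter> C = {..min p q}" by auto
      then show "B \<inter> C \<in> range (\<lambda>a::real. {..a})" by simp
    qed
  next
    fix B assume "B \<in> range (\<lambda>a::real. {..a})"
    then show "(LINT x:B|lborel. f x) = 0" using Iic by auto
  next
    fix B assume B: "B \<in> sigma_sets UNIV (range (\<lambda>a::real. {..a}))" "(LINT x:B|lborel. f x) = 0"
    have "(LINT x:(B \<union> (UNIV - B))|lborel. f x) = (LINT x:B|lborel. f x) + (LINT x:(UNIV - B)|lborel. f x)"
      using sets[OF B(1)] by (intro set_integral_Un int) auto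
    then show "(LINT x:(UNIV - B)|lborel. f x) = 0"
      using B(2) tot by (simp add: set_lebesgue_integral_def)
  next
    fix B :: "nat \<Rightarrow> real set"
    assume B: "disjoint_family B" "range B \<subseteq> sigma_sets UNIV (range (\<lambda>a::real. {..a}))"
      "\<And>i. (LINT x:B i|lborel. f x) = 0"
    then have "B i \<in> sets lborel" for i using sets by blast
    then show "(LINT x:(\<Union>i. B i)|lborel. f x) = 0"
      using B by (subst lebesgue_integral_countable_add) (auto intro!: int simp: disjoint_family_on_def)
  qed (auto simp: set_lebesgue_integral_def)
  then show "(LINT x:A|lborel. f x) = (LINT x:A|lborel. 0)" by simp
qed

text \<open>Instead of mollifying \<open>h\<close>, one tests with bumps on (a, c). They are bounded
  by 1 and tend to the indicator of (a, c), so dominated convergence turns the hypothesis into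
  vanishing integrals over all these intervals, which determine an integrable function almost
  everywhere.\<close>

lemma fundamental_lemma_Icc:
  assumes h: "locally_integrable S h" and ab: "{a..b} \<subseteq> S"
    and zero: "\<And>\<phi>. test_function S \<phi> \<Longrightarrow> (LINT s:S|lborel. h s * \<phi> s) = 0"
  shows "AE x in lborel. x \<in> {a..b} \<longrightarrow> h x = 0"
proof -
  define f where "f = (\<lambda>x. indicator {a..b} x *\<^sub>R h x)"
  have f: "integrable lborel f"
    using h ab unfolding locally_integrable_def set_integrable_def f_def by blast
  have Ioo: "(LINT x:{a<..<c}|lborel. f x) = 0" if c: "c \<le> b" for c
  proof -
    have bump_meas: "bump a c n \<in> borel_measurable borel" for n
      using test_function_bump[of a c UNIV n]
      by (auto simp: test_function_def intro!: borel_measurable_continuous_onI smooth_imp_continuous)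
    have "(\<lambda>n. LINT x|lborel. f x * bump a c n x) \<longlonglongrightarrow> (LINT x|lborel. f x * indicator {a<..<c} x)"
    proof (rule integral_dominated_convergence[where w = "\<lambda>x. \<bar>f x\<bar>"])
      show "AE x in lborel. (\<lambda>n. f x * bump a c n x) \<longlonglongrightarrow> f x * indicator {a<..<c} x"
        by (intro AE_I2 tendsto_intros tendsto_bump)
      show "AE x in lborel. norm (f x * bump a c n x) \<le> \<bar>f x\<bar>" for n
        by (intro AE_I2) (simp add: abs_mult mult_left_le bump_bounds)
    qed (use borel_measurable_integrable[OF f] f bump_meas in simp_all)
    moreover have "(LINT x|lborel. f x * bump a c n x) = 0" for n
    proof -
      have "(LINT x|lborel. f x * bump a c n x) = (LINT s:S|lborel. h s * bump a c n s)"
        unfolding set_lebesgue_integral_def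
      proof (rule Bochner_Integration.integral_cong)
        fix x
        show "f x * bump a c n x = indicator S x *\<^sub>R (h x * bump a c n x)"
        proof (cases "x \<in> {a<..<c}")
          case True
          then have "x \<in> {a..b}" using c by simp
          then show ?thesis using ab by (auto simp: f_def)
        next
          case False
          then show ?thesis by (simp add: bump_eq_0)
        qed
      qed simp
      also have "\<dots> = 0"
        using ab c by (intro zero test_function_bump) auto
      finally show ?thesis .
    qed
    ultimately show ?thesis
      by (simp add: LIMSEQ_const_iff set_lebesgue_integral_def mult.commute)
  qed
  \<comment> \<open>Outside [a, b] the function \<open>f\<close> is zero, and the two points a and c
    form a null set, so only the remaining points of [a, b] decide which sets give the same
    integral.\<close>
  have eq: "(LINT x:{a<..<c}|lborel. f x) = (LINT x:B|lborel. f x)"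
    if "\<And>x. x \<in> {a..b} - {a, c} \<Longrightarrow> x \<in> {a<..<c} \<longleftrightarrow> x \<in> B" "B \<in> sets lborel" for B c
    unfolding set_lebesgue_integral_def
  proof (rule integral_cong_AE)
    show "AE x in lborel. indicator {a<..<c} x *\<^sub>R f x = indicator B x *\<^sub>R f x"
      using AE_lborel_singleton[of a] AE_lborel_singleton[of c]
    proof eventually_elim
      fix x assume "x \<noteq> a" "x \<noteq> c"
      then show "indicator {a<..<c} x *\<^sub>R f x = indicator B x *\<^sub>R f x"
        using that(1)[of x] by (cases "x \<in> {a..b}") (auto simp: f_def indicator_def)
    qed
  qed (use borel_measurable_integrable[OF f] that(2) in simp_all)
  have "AE x in lborel. f x = 0"
  proof (rule AE_0_if_integral_atMost_0[OF f])
    show "(LINT x:{..c}|lborel. f x) = 0" for c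
    proof -
      have "(LINT x:{a<..<min b c}|lborel. f x) = (LINT x:{..c}|lborel. f x)"
        by (rule eq) (auto simp: min_def split: if_splits)
      then show ?thesis using Ioo[of "min b c"] by simp
    qed
    show "(LINT x|lborel. f x) = 0"
    proof -
      have "(LINT x:{a<..<b}|lborel. f x) = (LINT x:UNIV|lborel. f x)"
        by (rule eq) auto
      then show ?thesis using Ioo[of b] by (simp add: set_lebesgue_integral_def)
    qed
  qed
  then show ?thesis by eventually_elim (auto simp: f_def)
qed

lemma fundamental_lemma:
  assumes S: "open S" and h: "locally_integrable S h"
    and zero: "\<And>\<phi>. test_function S \<phi> \<Longrightarrow> (LINT s:S|lborel. h s * \<phi> s) = 0"
  shows "AE x in lborel. x \<in> S \<longrightarrow> h x = 0"
proof -
  \<comment> \<open>Rational endpoints keep the family countable, so the exceptional null sets can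
    be united; since \<open>S\<close> is open, these intervals still cover it.\<close>
  define Q where "Q = {p \<in> \<rat> \<times> \<rat>. {fst p..snd p} \<subseteq> S}"
  have "countable Q"
    by (rule countable_subset[of _ "\<rat> \<times> \<rat>"]) (auto simp: Q_def countable_rat)
  then have "AE x in lborel. \<forall>p\<in>Q. x \<in> {fst p..snd p} \<longrightarrow> h x = 0"
    using fundamental_lemma_Icc[OF h _ zero] by (subst AE_ball_countable) (auto simp: Q_def)
  then show ?thesis
  proof eventually_elim
    fix x assume x: "\<forall>p\<in>Q. x \<in> {fst p..snd p} \<longrightarrow> h x = 0"
    show "x \<in> S \<longrightarrow> h x = 0"
    proof
      assume "x \<in> S"
      then obtain e where e: "e > 0" "ball x e \<subseteq> S" using S by (meson openE)
      obtain a where a: "a \<in> \<rat>" "x - e < a" "a < x"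
        using e(1) Rats_dense_in_real[of "x - e" x] by auto
      obtain b where b: "b \<in> \<rat>" "x < b" "b < x + e"
        using e(1) Rats_dense_in_real[of x "x + e"] by auto
      have "{a..b} \<subseteq> ball x e" using a b by (auto simp: dist_real_def)
      then have "(a, b) \<in> Q" using a b e(2) by (auto simp: Q_def)
      moreover have "x \<in> {a..b}" using a b by simp
      ultimately show "h x = 0" using x by (metis fst_conv snd_conv)
    qed
  qed
qed

lemma compact_support_bounded:
  assumes "continuous_on UNIV \<phi>" "compact (closure {s. \<phi> s \<noteq> (0::real)})"
  obtains B where "\<And>s :: real. \<bar>\<phi> s\<bar> \<le> B"
proof -
  have "compact (\<phi> ` closure {s. \<phi> s \<noteq> 0})"
    using assms by (intro compact_continuous_image continuous_on_subset[OF assms(1)]) auto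
  then have "bounded (\<phi> ` closure {s. \<phi> s \<noteq> 0})" by (rule compact_imp_bounded)
  then obtain B where B: "\<And>s. s \<in> closure {s. \<phi> s \<noteq> 0} \<Longrightarrow> \<bar>\<phi> s\<bar> \<le> B"
    unfolding bounded_iff by (metis imageI real_norm_def)
  have "\<bar>\<phi> s\<bar> \<le> max B 0" for s
  proof (cases "\<phi> s = 0")
    case False
    then show ?thesis using B[of s] closure_subset[of "{s. \<phi> s \<noteq> 0}"] by force
  qed simp
  then show ?thesis by (rule that)
qed

lemma set_integrable_mult_test_function:
  assumes h: "locally_integrable S h" and \<phi>: "test_function S \<phi>"
  shows "set_integrable lborel S (\<lambda>s. h s * \<phi> s)"
proof -
  let ?K = "closure {s. \<phi> s \<noteq> 0}"
  have cont: "continuous_on UNIV \<phi>" and K: "compact ?K" "?K \<subseteq> S"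
    using \<phi> smooth_imp_continuous by (auto simp: test_function_def)
  obtain B where B: "\<And>s. \<bar>\<phi> s\<bar> \<le> B"
    using compact_support_bounded[OF cont K(1)] by blast
  have int: "integrable lborel (\<lambda>s. indicator ?K s *\<^sub>R h s)"
    using h K unfolding locally_integrable_def set_integrable_def by blast
  have "(\<lambda>s. indicator S s *\<^sub>R (h s * \<phi> s)) = (\<lambda>s. (indicator ?K s *\<^sub>R h s) * \<phi> s)"
    using K closure_subset[of "{s. \<phi> s \<noteq> 0}"] by (auto simp: indicator_def fun_eq_iff)
  moreover have "integrable lborel (\<lambda>s. (indicator ?K s *\<^sub>R h s) * \<phi> s)"
  proof (rule Bochner_Integration.integrable_bound)
    show "integrable lborel (\<lambda>s. B * norm (indicator ?K s *\<^sub>R h s))" using int by simp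
    show "(\<lambda>s. indicator ?K s *\<^sub>R h s * \<phi> s) \<in> borel_measurable lborel"
      using borel_measurable_integrable[OF int] borel_measurable_continuous_onI[OF cont] by simp
    show "AE s in lborel. norm (indicator ?K s *\<^sub>R h s * \<phi> s) \<le> norm (B * norm (indicator ?K s *\<^sub>R h s))"
    proof (rule AE_I2)
      fix s
      have "\<bar>indicator ?K s *\<^sub>R h s\<bar> * \<bar>\<phi> s\<bar> \<le> \<bar>indicator ?K s *\<^sub>R h s\<bar> * B"
        by (intro mult_left_mono B) simp
      then show "norm (indicator ?K s *\<^sub>R h s * \<phi> s) \<le> norm (B * norm (indicator ?K s *\<^sub>R h s))"
        using B[of s] by (simp add: abs_mult mult.commute)
    qed
  qed
  ultimately show ?thesis unfolding set_integrable_def by simp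
qed

lemma weak_deriv_unique:
  assumes S: "open S" and h: "weak_deriv S f h" "weak_deriv S f h'"
  shows "AE x in lborel. x \<in> S \<longrightarrow> h x = h' x"
proof -
  have loc: "locally_integrable S h" "locally_integrable S h'" using h by (auto simp: weak_deriv_def)
  have "AE x in lborel. x \<in> S \<longrightarrow> h x - h' x = 0"
  proof (rule fundamental_lemma[OF S])
    show "locally_integrable S (\<lambda>x. h x - h' x)"
      using loc set_integral_diff(1) unfolding locally_integrable_def by metis
    fix \<phi> assume \<phi>: "test_function S \<phi>"
    have "- (LINT s:S|lborel. h s * \<phi> s) = - (LINT s:S|lborel. h' s * \<phi> s)"
      using h[unfolded weak_deriv_def, THEN conjunct2, THEN conjunct2, rule_format, OF \<phi>] by (rule trans[OF sym])
    then have "(LINT s:S|lborel. h s * \<phi> s) - (LINT s:S|lborel. h' s * \<phi> s) = 0" by simp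
    then show "(LINT s:S|lborel. (h s - h' s) * \<phi> s) = 0"
      unfolding left_diff_distrib
      using set_integral_diff(2)[OF loc[THEN set_integrable_mult_test_function, OF \<phi>]] by argo
  qed
  then show ?thesis by simp
qed

subsection \<open>Sobolev norms along arcs\<close>

text \<open>Local integrability gives measurability on each compact subset only. An increasing
  exhaustion of \<open>S\<close> by compact sets exhibits the function as a pointwise limit.\<close>

lemma locally_integrable_measurable:
  assumes S: "open S" and f: "locally_integrable S f"
  shows "set_borel_measurable lborel S f"
proof -
  obtain K where K: "\<And>n. compact (K n)" "\<And>n. K n \<subseteq> S" "\<And>n. K n \<subseteq> interior (K (Suc n))"
      "\<Union>(range K) = S"
    using open_Union_compact_subsets[OF S] by metis
  have "incseq K"
    using K(3) interior_subset by (intro incseq_SucI) blast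
  show ?thesis
    unfolding set_borel_measurable_def
  proof (rule borel_measurable_LIMSEQ_metric)
    show "(\<lambda>x. indicator (K n) x *\<^sub>R f x) \<in> borel_measurable lborel" for n
      using f K(1,2) unfolding locally_integrable_def set_integrable_def
      by (blast intro: borel_measurable_integrable)
    show "(\<lambda>n. indicator (K n) x *\<^sub>R f x) \<longlonglongrightarrow> indicator S x *\<^sub>R f x" for x
      using LIMSEQ_indicator_incseq[OF \<open>incseq K\<close>, of x] K(4) by (intro tendsto_scaleR) auto
  qed
qed

text \<open>A common interface for the segment and the boundary of the quarter plane. Here \<rho>
  recovers the parameter of a point of \<open>C\<close>; its measurability carries measurability
  from the parameter set back to the curve. The last assumption is only almost everywhere so that
  the arc may pass through the corner, which is not in \<open>quarter_bdry\<close>.\<close>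

locale plane_arc =
  fixes \<gamma> :: "real \<Rightarrow> real \<times> real" and \<rho> :: "real \<times> real \<Rightarrow> real" and S C
  assumes open_S: "open S"
    and measurable_\<gamma>: "\<gamma> \<in> borel_measurable borel"
    and measurable_\<rho>: "\<rho> \<in> borel_measurable borel"
    and sets_C: "C \<in> sets borel"
    and \<gamma>_\<rho>: "\<And>x. x \<in> C \<Longrightarrow> \<rho> x \<in> S \<and> \<gamma> (\<rho> x) = x"
    and AE_\<gamma>: "AE s in lborel. s \<in> S \<longrightarrow> \<gamma> s \<in> C"
begin

lemma
  fixes f :: "real \<times> real \<Rightarrow> real"
  assumes f: "set_borel_measurable lborel S (\<lambda>s. f (\<gamma> s))"
  shows set_integrable_arc_iff:
      "set_integrable (arc_measure \<gamma> S) C f \<longleftrightarrow> set_integrable lborel S (\<lambda>s. f (\<gamma> s))" (is ?A)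
    and set_integral_arc:
      "(LINT x:C|arc_measure \<gamma> S. f x) = (LINT s:S|lborel. f (\<gamma> s))" (is ?B)
proof -
  let ?F = "\<lambda>x. indicator C x *\<^sub>R f x"
  have S: "S \<in> sets borel" using open_S by simp
  have fS: "(\<lambda>s. indicator S s *\<^sub>R f (\<gamma> s)) \<in> borel_measurable borel"
    using f by (simp add: set_borel_measurable_def)
  \<comment> \<open>Integration against an image measure requires a Borel integrand on the plane,
    whereas \<open>f\<close> is known to be measurable only along \<gamma>. On \<open>C\<close> it
    is recovered as the composition of \<open>f \<circ> \<gamma>\<close> with \<rho>.\<close>
  have "(\<lambda>x. indicator C x *\<^sub>R (indicator S (\<rho> x) *\<^sub>R f (\<gamma> (\<rho> x)))) \<in> borel_measurable borel"
    using measurable_compose[OF measurable_\<rho> fS] sets_C by simp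
  also have "(\<lambda>x. indicator C x *\<^sub>R (indicator S (\<rho> x) *\<^sub>R f (\<gamma> (\<rho> x)))) = ?F"
    using \<gamma>_\<rho> by (auto simp: indicator_def fun_eq_iff)
  finally have F: "?F \<in> borel_measurable borel" .
  have \<gamma>: "\<gamma> \<in> measurable (restrict_space lborel S) borel"
    using measurable_\<gamma> by (intro measurable_restrict_space1) simp
  have meas: "(\<lambda>s. indicator S s *\<^sub>R ?F (\<gamma> s)) \<in> borel_measurable lborel"
    using measurable_compose[OF measurable_\<gamma> F] S by simp
  have eq: "AE s in lborel. indicator S s *\<^sub>R ?F (\<gamma> s) = indicator S s *\<^sub>R f (\<gamma> s)"
    using AE_\<gamma> by eventually_elim (auto simp: indicator_def)
  have "integrable lborel (\<lambda>s. indicator S s *\<^sub>R ?F (\<gamma> s)) \<longleftrightarrow> integrable lborel (\<lambda>s. indicator S s *\<^sub>R f (\<gamma> s))"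
    using eq meas fS by (intro integrable_cong_AE) simp_all
  then show ?A
    unfolding set_integrable_def arc_measure_def integrable_distr_eq[OF \<gamma> F]
    using S by (simp add: integrable_restrict_space)
  have "integral\<^sup>L lborel (\<lambda>s. indicator S s *\<^sub>R ?F (\<gamma> s)) = integral\<^sup>L lborel (\<lambda>s. indicator S s *\<^sub>R f (\<gamma> s))"
    using eq meas fS by (intro integral_cong_AE) simp_all
  then show ?B
    unfolding set_lebesgue_integral_def arc_measure_def integral_distr[OF \<gamma> F]
    using S by (simp add: integral_restrict_space)
qed

lemma set_borel_measurable_weighted:
  assumes "(\<lambda>s. w (\<gamma> s)) \<in> borel_measurable borel" "locally_integrable S (g \<circ> \<gamma>)"
  shows "set_borel_measurable lborel S (\<lambda>s. (w (\<gamma> s) :: real) * (g (\<gamma> s))\<^sup>2)"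
proof -
  have "(\<lambda>s. w (\<gamma> s) * (indicator S s *\<^sub>R g (\<gamma> s))\<^sup>2) \<in> borel_measurable lborel"
    using locally_integrable_measurable[OF open_S assms(2)] assms(1)
    by (simp add: set_borel_measurable_def)
  also have "(\<lambda>s. w (\<gamma> s) * (indicator S s *\<^sub>R g (\<gamma> s))\<^sup>2) = (\<lambda>s. indicator S s *\<^sub>R (w (\<gamma> s) * (g (\<gamma> s))\<^sup>2))"
    by (auto simp: indicator_def)
  finally show ?thesis by (simp add: set_borel_measurable_def)
qed

lemma sobolev_space_iff:
  assumes w: "(\<lambda>s. w\<^sub>0 (\<gamma> s)) \<in> borel_measurable borel" "(\<lambda>s. w\<^sub>1 (\<gamma> s)) \<in> borel_measurable borel"
  shows "g \<in> sobolev_space \<gamma> S C w\<^sub>0 w\<^sub>1 \<longleftrightarrow>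
    (\<exists>h. weak_deriv S (g \<circ> \<gamma>) (h \<circ> \<gamma>) \<and>
      set_integrable lborel S (\<lambda>s. w\<^sub>0 (\<gamma> s) * (g (\<gamma> s))\<^sup>2) \<and>
      set_integrable lborel S (\<lambda>s. w\<^sub>1 (\<gamma> s) * (h (\<gamma> s))\<^sup>2))"
proof -
  have "weak_deriv S (g \<circ> \<gamma>) (h \<circ> \<gamma>) \<Longrightarrow>
     set_integrable (arc_measure \<gamma> S) C (\<lambda>x. w\<^sub>0 x * (g x)\<^sup>2) = set_integrable lborel S (\<lambda>s. w\<^sub>0 (\<gamma> s) * (g (\<gamma> s))\<^sup>2) \<and>
     set_integrable (arc_measure \<gamma> S) C (\<lambda>x. w\<^sub>1 x * (h x)\<^sup>2) = set_integrable lborel S (\<lambda>s. w\<^sub>1 (\<gamma> s) * (h (\<gamma> s))\<^sup>2)" for h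
    using w by (intro conjI set_integrable_arc_iff set_borel_measurable_weighted) (auto simp: weak_deriv_def)
  then show ?thesis
    unfolding sobolev_space_def is_tangential_deriv_def by blast
qed

lemma sobolev_norm_eq:
  assumes w: "(\<lambda>s. w\<^sub>0 (\<gamma> s)) \<in> borel_measurable borel" "(\<lambda>s. w\<^sub>1 (\<gamma> s)) \<in> borel_measurable borel"
    and h: "weak_deriv S (g \<circ> \<gamma>) (h \<circ> \<gamma>)"
  shows "sobolev_norm \<gamma> S C w\<^sub>0 w\<^sub>1 g =
    sqrt (LINT s:S|lborel. w\<^sub>0 (\<gamma> s) * (g (\<gamma> s))\<^sup>2 + w\<^sub>1 (\<gamma> s) * (h (\<gamma> s))\<^sup>2)"
proof -
  define d where "d = tangential_deriv \<gamma> S g"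
  have d: "weak_deriv S (g \<circ> \<gamma>) (d \<circ> \<gamma>)"
    \<comment> \<open>The existence of \<open>h\<close> guarantees that \<open>SOME\<close> returns
      a genuine weak derivative.\<close>
    using someI[of "is_tangential_deriv \<gamma> S g" h] h
    unfolding d_def tangential_deriv_def is_tangential_deriv_def by blast
  have ae: "AE s in lborel. s \<in> S \<longrightarrow> d (\<gamma> s) = h (\<gamma> s)"
    using weak_deriv_unique[OF open_S d h] by simp
  have meas: "set_borel_measurable lborel S (\<lambda>s. w\<^sub>0 (\<gamma> s) * (g (\<gamma> s))\<^sup>2 + w\<^sub>1 (\<gamma> s) * (e (\<gamma> s))\<^sup>2)"
    if "weak_deriv S (g \<circ> \<gamma>) (e \<circ> \<gamma>)" for e
    using set_borel_measurable_weighted[OF w(1), of g] set_borel_measurable_weighted[OF w(2), of e] that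
    by (simp add: weak_deriv_def set_borel_measurable_def distrib_left)
  have "(LINT x:C|arc_measure \<gamma> S. w\<^sub>0 x * (g x)\<^sup>2 + w\<^sub>1 x * (d x)\<^sup>2) =
      (LINT s:S|lborel. w\<^sub>0 (\<gamma> s) * (g (\<gamma> s))\<^sup>2 + w\<^sub>1 (\<gamma> s) * (d (\<gamma> s))\<^sup>2)"
    by (rule set_integral_arc) (rule meas[OF d])
  also have "\<dots> = (LINT s:S|lborel. w\<^sub>0 (\<gamma> s) * (g (\<gamma> s))\<^sup>2 + w\<^sub>1 (\<gamma> s) * (h (\<gamma> s))\<^sup>2)"
  proof -
    have "AE s in lborel. indicator S s *\<^sub>R (w\<^sub>0 (\<gamma> s) * (g (\<gamma> s))\<^sup>2 + w\<^sub>1 (\<gamma> s) * (d (\<gamma> s))\<^sup>2)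
        = indicator S s *\<^sub>R (w\<^sub>0 (\<gamma> s) * (g (\<gamma> s))\<^sup>2 + w\<^sub>1 (\<gamma> s) * (h (\<gamma> s))\<^sup>2)"
      using ae by eventually_elim (auto simp: indicator_def)
    then show ?thesis
      unfolding set_lebesgue_integral_def
      using meas[OF d] meas[OF h] by (intro integral_cong_AE) (simp_all add: set_borel_measurable_def)
  qed
  finally show ?thesis by (simp add: sobolev_norm_def d_def)
qed

end

interpretation segment: plane_arc gamma_in snd "{0<..<1}" Gamma_in
proof
  show "gamma_in \<in> borel_measurable borel"
    unfolding gamma_in_def by measurable
  show "Gamma_in \<in> sets borel"
    unfolding Gamma_in_def borel_prod[symmetric] by simp
qed (auto simp: gamma_in_def Gamma_in_def measurable_snd'' borel_prod[symmetric] intro: measurable_snd)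

text \<open>The two summands of the parameter are active on different sides: on the vertical
  half-line the first coordinate is l, on the horizontal one the second is 0. A single continuous
  formula thus inverts both branches of \<open>quarter_arc\<close>.\<close>

interpretation quarter: plane_arc "quarter_arc l" "\<lambda>x. snd x - (fst x - l)" UNIV "quarter_bdry l" for l
proof
  show "quarter_arc l \<in> borel_measurable borel"
    unfolding quarter_arc_def by measurable
  show "(\<lambda>x::real \<times> real. snd x - (fst x - l)) \<in> borel_measurable borel"
    by (intro borel_measurable_continuous_onI continuous_intros)
  show "quarter_bdry l \<in> sets borel"
    unfolding quarter_bdry_def borel_prod[symmetric] by (intro sets.Un pair_measureI) auto
  show "AE s in lborel. s \<in> UNIV \<longrightarrow> quarter_arc l s \<in> quarter_bdry l"
    using AE_lborel_singleton[of 0] by eventually_elim (auto simp: quarter_arc_def quarter_bdry_def)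
qed (auto simp: quarter_arc_def quarter_bdry_def)

subsection \<open>Integration by parts\<close>

text \<open>Off the closed support the function is locally zero, so its derivative vanishes there.
  This makes products of locally integrable functions with \<open>deriv \<phi>\<close> integrable,
  as needed to split integrals by linearity.\<close>

lemma test_function_deriv:
  assumes "test_function S \<phi>"
  shows "test_function S (deriv \<phi>)"
proof -
  let ?K = "closure {s. \<phi> s \<noteq> 0}"
  have "deriv \<phi> s = 0" if "s \<notin> ?K" for s
  proof -
    have "(\<phi> has_real_derivative 0) (at s)"
      by (rule has_field_derivative_transform_within_open[of "\<lambda>_. 0" _ _ "- ?K"])
        (use that closure_subset[of "{s. \<phi> s \<noteq> 0}"] in auto)
    then show ?thesis by (rule DERIV_imp_deriv)
  qed
  then have sub: "closure {s. deriv \<phi> s \<noteq> 0} \<subseteq> ?K"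
    by (intro closure_minimal) auto
  then have "compact (closure {s. deriv \<phi> s \<noteq> 0})"
    using assms unfolding test_function_def
    by (meson bounded_subset closed_closure compact_eq_bounded_closed)
  then show ?thesis
    using sub assms smooth_deriv unfolding test_function_def by auto
qed

lemma weak_deriv_diff:
  assumes "weak_deriv S f f'" "weak_deriv S g g'"
  shows "weak_deriv S (\<lambda>s. f s - g s) (\<lambda>s. f' s - g' s)"
proof -
  have loc: "locally_integrable S f" "locally_integrable S g" "locally_integrable S f'" "locally_integrable S g'"
    using assms by (auto simp: weak_deriv_def)
  have diff: "locally_integrable S (\<lambda>s. p s - q s)" if "locally_integrable S p" "locally_integrable S q" for p q
    using that set_integral_diff(1) unfolding locally_integrable_def by metis
  have "(LINT s:S|lborel. (f s - g s) * deriv \<phi> s) = - (LINT s:S|lborel. (f' s - g' s) * \<phi> s)"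
    if \<phi>: "test_function S \<phi>" for \<phi>
  proof -
    have "(LINT s:S|lborel. f s * deriv \<phi> s) = - (LINT s:S|lborel. f' s * \<phi> s)"
      "(LINT s:S|lborel. g s * deriv \<phi> s) = - (LINT s:S|lborel. g' s * \<phi> s)"
      using assms \<phi> by (auto simp: weak_deriv_def)
    then show ?thesis
      unfolding left_diff_distrib
      by (simp add: set_integral_diff(2) set_integrable_mult_test_function loc \<phi> test_function_deriv)
  qed
  then show ?thesis using loc diff by (simp add: weak_deriv_def)
qed

lemma set_integrable_continuous:
  fixes f :: "real \<Rightarrow> real"
  assumes "continuous_on UNIV f" "bounded S" "S \<in> sets borel"
  shows "set_integrable lborel S f"
proof -
  obtain a b where ab: "S \<subseteq> {a..b}"
    using bounded_subset_cbox_symmetric[OF assms(2)] by (metis cbox_interval)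
  have "set_integrable lborel {a..b} f"
    by (intro borel_integrable_atLeastAtMost' continuous_on_subset[OF assms(1)]) auto
  then show ?thesis
    by (rule set_integrable_subset) (use ab assms(3) in auto)
qed

lemma set_integrable_mult_continuous:
  fixes f g :: "real \<Rightarrow> real"
  assumes f: "set_integrable lborel S f" and g: "continuous_on UNIV g" and S: "bounded S"
  shows "set_integrable lborel S (\<lambda>s. f s * g s)"
proof -
  have "bounded (g ` closure S)"
    using S g by (intro compact_imp_bounded compact_continuous_image continuous_on_subset[OF g])
      (auto simp: compact_closure)
  then obtain B where B: "\<And>s. s \<in> S \<Longrightarrow> \<bar>g s\<bar> \<le> B"
    using closure_subset[of S] unfolding bounded_iff by (metis imageI real_norm_def subsetD)
  have f': "(\<lambda>s. indicator S s *\<^sub>R f s) \<in> borel_measurable borel"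
    using borel_measurable_integrable[OF f[unfolded set_integrable_def]] by simp
  have "integrable lborel (\<lambda>s. (indicator S s *\<^sub>R f s) * g s)"
  proof (rule Bochner_Integration.integrable_bound)
    show "integrable lborel (\<lambda>s. (indicator S s *\<^sub>R f s) * B)"
      using f by (simp add: set_integrable_def)
    show "(\<lambda>s. (indicator S s *\<^sub>R f s) * g s) \<in> borel_measurable lborel"
      using f' borel_measurable_continuous_onI[OF g] by (intro borel_measurable_times) simp_all
    have "norm ((indicator S s *\<^sub>R f s) * g s) \<le> norm ((indicator S s *\<^sub>R f s) * B)" for s
    proof (cases "s \<in> S")
      case True
      from order_trans[OF B[OF True] abs_ge_self] show ?thesis
        by (simp add: abs_mult mult_left_mono)
    qed simp
    then show "AE s in lborel. norm ((indicator S s *\<^sub>R f s) * g s) \<le> norm ((indicator S s *\<^sub>R f s) * B)"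
      by simp
  qed
  then show ?thesis by (simp add: set_integrable_def mult.assoc)
qed

lemma locally_integrableI: "set_integrable lborel S f \<Longrightarrow> locally_integrable S f"
  unfolding locally_integrable_def by (metis set_integrable_subset compact_imp_closed borel_closed sets_lborel)

text \<open>Only \<open>f\<close> vanishes at the endpoints, which already kills the boundary term;
  \<open>g\<close> is free there, as the later use with arbitrary C1 functions demands.\<close>

lemma integration_by_parts_vanishing:
  fixes f g f' g' :: "real \<Rightarrow> real"
  assumes ab: "a \<le> b"
    and f: "\<And>x. (f has_real_derivative f' x) (at x)" "continuous_on UNIV f'" "f a = 0" "f b = 0"
    and g: "\<And>x. (g has_real_derivative g' x) (at x)" "continuous_on UNIV g'"
  shows "(LINT s:{a<..<b}|lborel. f s * g' s) = - (LINT s:{a<..<b}|lborel. f' s * g s)"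
proof -
  have cont: "continuous_on UNIV f" "continuous_on UNIV g"
    using f(1) g(1) by (meson DERIV_isCont continuous_at_imp_continuous_on)+
  have "(LINT x|lborel. (f x * g' x + f' x * g x) * indicator {a..b} x) = f b * g b - f a * g a"
    using f g cont
    by (intro integral_FTC_Icc_real ab)
      (auto intro!: derivative_eq_intros continuous_intros simp: continuous_on_eq_continuous_at)
  then have "(LINT s:{a..b}|lborel. f s * g' s + f' s * g s) = 0"
    using f by (simp add: set_lebesgue_integral_def mult.commute)
  moreover have "(LINT s:{a..b}|lborel. f s * g' s + f' s * g s) = (LINT s:{a<..<b}|lborel. f s * g' s + f' s * g s)"
    by (rule set_integral_discrete_difference[of "{a, b}"]) auto
  moreover have "(LINT s:{a<..<b}|lborel. f s * g' s + f' s * g s) =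
      (LINT s:{a<..<b}|lborel. f s * g' s) + (LINT s:{a<..<b}|lborel. f' s * g s)"
    by (intro set_integral_add set_integrable_continuous continuous_intros cont f g) auto
  ultimately show ?thesis by simp
qed

lemma weak_deriv_test_function:
  assumes \<Phi>: "test_function {a<..<b} \<Phi>" and "a \<le> b"
  shows "weak_deriv {a<..<b} \<Phi> (deriv \<Phi>)"
proof -
  have zero: "\<Phi> a = 0" "\<Phi> b = 0"
    using \<Phi> closure_subset[of "{s. \<Phi> s \<noteq> 0}"] by (force simp: test_function_def)+
  have smooth: "smooth \<Phi>" using \<Phi> by (simp add: test_function_def)
  then have cont: "continuous_on UNIV \<Phi>" "continuous_on UNIV (deriv \<Phi>)"
    using smooth_deriv smooth_imp_continuous by auto
  show ?thesis
    unfolding weak_deriv_def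
  proof (intro conjI allI impI locally_integrableI set_integrable_continuous cont)
    fix \<phi> assume "test_function {a<..<b} \<phi>"
    then have "smooth \<phi>" by (simp add: test_function_def)
    then show "(LINT s:{a<..<b}|lborel. \<Phi> s * deriv \<phi> s) = - (LINT s:{a<..<b}|lborel. deriv \<Phi> s * \<phi> s)"
      using smooth_deriv smooth_imp_continuous smooth_imp_DERIV smooth zero assms(2)
      by (intro integration_by_parts_vanishing) auto
  qed auto
qed

text \<open>From |x| \<le> 1 + x^2, where the constant is integrable because \<open>S\<close> is
  bounded.\<close>

lemma set_integrable_if_square:
  fixes f :: "real \<Rightarrow> real"
  assumes f: "set_borel_measurable lborel S f" "set_integrable lborel S (\<lambda>s. (f s)\<^sup>2)"
    and S: "bounded S" "S \<in> sets borel"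
  shows "set_integrable lborel S f"
proof (rule set_integrable_bound)
  show "set_integrable lborel S (\<lambda>s. 1 + (f s)\<^sup>2)"
    by (intro set_integral_add(1) f set_integrable_continuous S continuous_on_const)
  show "set_borel_measurable lborel S f" by (rule f)
  have "\<bar>f s\<bar> \<le> 1 + (f s)\<^sup>2" for s
    using zero_le_power2[of "\<bar>f s\<bar> - 1"] unfolding power2_diff power2_abs by simp
  then show "AE s in lborel. s \<in> S \<longrightarrow> norm (f s) \<le> norm (1 + (f s)\<^sup>2)"
    by (intro AE_I2) (simp add: abs_of_nonneg add_nonneg_nonneg)
qed

lemma set_integrable_diff_square:
  fixes f g :: "real \<Rightarrow> real"
  assumes f: "set_integrable lborel S f" "set_integrable lborel S (\<lambda>s. (f s)\<^sup>2)"
    and g: "continuous_on UNIV g" and S: "bounded S" "S \<in> sets borel"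
  shows "set_integrable lborel S (\<lambda>s. (f s - g s)\<^sup>2)"
proof -
  have "set_integrable lborel S (\<lambda>s. (f s)\<^sup>2 + (g s)\<^sup>2 - 2 * (f s * g s))"
    by (intro set_integral_diff set_integral_add set_integrable_mult_right f g S
        set_integrable_mult_continuous set_integrable_continuous continuous_intros)
  then show ?thesis by (simp add: power2_diff mult.assoc)
qed

text \<open>The last clause stands in for zero boundary values: \<psi> may be nonzero at 0 and 1.
  For \<open>v\<close> continuously differentiable up to the ends it would say that v \<psi> takes
  the same value at 0 and 1 for every such \<psi>, which forces \<open>v\<close> to vanish at
  both.\<close>

lemma H10_in_weak_derivE:
  assumes v: "v \<in> H10_in"
  obtains h :: "real \<Rightarrow> real" where
    "locally_integrable {0<..<1} (\<lambda>s. v (0, s))" "locally_integrable {0<..<1} h"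
    "set_integrable lborel {0<..<1} (\<lambda>s. v (0, s))" "set_integrable lborel {0<..<1} h"
    "set_integrable lborel {0<..<1} (\<lambda>s. (v (0, s))\<^sup>2)" "set_integrable lborel {0<..<1} (\<lambda>s. (h s)\<^sup>2)"
    "H10_in_norm v = sqrt (LINT s:{0<..<1}|lborel. (v (0, s))\<^sup>2 + (h s)\<^sup>2)"
    "\<And>\<psi> \<psi>'. (\<And>x. (\<psi> has_real_derivative \<psi>' x) (at x)) \<Longrightarrow> continuous_on UNIV \<psi>' \<Longrightarrow>
       (LINT s:{0<..<1}|lborel. v (0, s) * \<psi>' s) = - (LINT s:{0<..<1}|lborel. h s * \<psi> s)"
proof -
  let ?I = "{0<..<1::real}"
  define u where "u = (\<lambda>s. v (0, s))"
  have norm_eq: "H1_in_norm g = sqrt (LINT s:?I|lborel. (g (0, s))\<^sup>2 + (h s)\<^sup>2)"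
    if "weak_deriv ?I (\<lambda>s. g (0, s)) h" for g h
    using that segment.sobolev_norm_eq[of "\<lambda>_. 1" "\<lambda>_. 1" g "h \<circ> snd"]
    unfolding H1_in_norm_def by (simp add: gamma_in_def o_def)
  from v have "v \<in> H1_in" by (simp add: H10_in_def)
  then obtain h0 where h0: "weak_deriv ?I (v \<circ> gamma_in) (h0 \<circ> gamma_in)"
      "set_integrable lborel ?I (\<lambda>s. (v (gamma_in s))\<^sup>2)" "set_integrable lborel ?I (\<lambda>s. (h0 (gamma_in s))\<^sup>2)"
    unfolding H1_in_def by (subst (asm) segment.sobolev_space_iff) auto
  define h where "h = h0 \<circ> gamma_in"
  have weak: "weak_deriv ?I u h" and sq: "set_integrable lborel ?I (\<lambda>s. (u s)\<^sup>2)" "set_integrable lborel ?I (\<lambda>s. (h s)\<^sup>2)"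
    using h0 by (simp_all add: u_def h_def gamma_in_def o_def)
  then have loc: "locally_integrable ?I u" "locally_integrable ?I h" by (auto simp: weak_deriv_def)
  then have int: "set_integrable lborel ?I u" "set_integrable lborel ?I h"
    using sq by (auto intro!: set_integrable_if_square locally_integrable_measurable)
  obtain \<phi> where \<phi>: "\<And>n. test_function ?I (\<phi> n \<circ> gamma_in)"
      "(\<lambda>n. H1_in_norm (\<lambda>x. v x - \<phi> n x)) \<longlonglongrightarrow> 0"
    using v unfolding H10_in_def by auto
  define \<Phi> where "\<Phi> n = \<phi> n \<circ> gamma_in" for n
  have test: "test_function ?I (\<Phi> n)" for n using \<phi>(1) by (simp add: \<Phi>_def)
  then have smooth: "smooth (\<Phi> n)" for n by (simp add: test_function_def)
  then have cont: "continuous_on UNIV (\<Phi> n)" "continuous_on UNIV (deriv (\<Phi> n))" for n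
    using smooth_deriv smooth_imp_continuous by auto
  \<comment> \<open>\<open>J n\<close> is the squared H1 distance from \<open>v\<close> to the
    approximating test function.\<close>
  define J where "J n = (LINT s:?I|lborel. (u s - \<Phi> n s)\<^sup>2 + (h s - deriv (\<Phi> n) s)\<^sup>2)" for n
  have J_nonneg: "0 \<le> J n" for n
    unfolding J_def set_lebesgue_integral_def by (intro integral_nonneg_AE AE_I2) auto
  have "H1_in_norm (\<lambda>x. v x - \<phi> n x) = sqrt (J n)" for n
    using norm_eq[of "\<lambda>x. v x - \<phi> n x"] weak_deriv_diff[OF weak weak_deriv_test_function[OF test]]
    unfolding J_def u_def \<Phi>_def o_def gamma_in_def by simp
  with \<phi>(2) have "(\<lambda>n. (sqrt (J n))\<^sup>2) \<longlonglongrightarrow> 0\<^sup>2"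
    by (intro tendsto_power) simp
  then have J: "J \<longlonglongrightarrow> 0" using J_nonneg by simp
  have sqd: "set_integrable lborel ?I (\<lambda>s. (u s - \<Phi> n s)\<^sup>2)"
      "set_integrable lborel ?I (\<lambda>s. (h s - deriv (\<Phi> n) s)\<^sup>2)" for n
    by (intro set_integrable_diff_square sq int cont; simp)+
  have parts: "(LINT s:?I|lborel. u s * \<psi>' s) = - (LINT s:?I|lborel. h s * \<psi> s)"
    if \<psi>: "\<And>x. (\<psi> has_real_derivative \<psi>' x) (at x)" and \<psi>': "continuous_on UNIV \<psi>'" for \<psi> \<psi>'
  proof -
    define D where "D = (LINT s:?I|lborel. u s * \<psi>' s + h s * \<psi> s)"
    have cont_\<psi>: "continuous_on UNIV \<psi>"
      using \<psi> by (meson DERIV_isCont continuous_at_imp_continuous_on)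
    have "bounded (\<psi> ` {0..1})" "bounded (\<psi>' ` {0..1})"
      using cont_\<psi> \<psi>' by (auto intro!: compact_imp_bounded compact_continuous_image intro: continuous_on_subset)
    then obtain M1 M2 where "\<And>s. s \<in> {0..1} \<Longrightarrow> \<bar>\<psi> s\<bar> \<le> M1" "\<And>s. s \<in> {0..1} \<Longrightarrow> \<bar>\<psi>' s\<bar> \<le> M2"
      unfolding bounded_iff by (metis imageI real_norm_def)
    then have bd: "\<bar>\<psi> s\<bar> \<le> max M1 M2" "\<bar>\<psi>' s\<bar> \<le> max M1 M2" if "s \<in> {0..1}" for s
      using that by (meson le_max_iff_disj)+
    define M where "M = max M1 M2"
    have M: "\<bar>\<psi> s\<bar> \<le> M" "\<bar>\<psi>' s\<bar> \<le> M" if "s \<in> {0..1}" for s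
      using bd that by (auto simp: M_def)
    have M0: "0 \<le> M" using M(1)[of 0] by simp
    have mult: "set_integrable lborel ?I (\<lambda>s. p s * q s)"
      if "set_integrable lborel ?I p" "continuous_on UNIV q" for p q :: "real \<Rightarrow> real"
      using that by (intro set_integrable_mult_continuous) auto
    have cint: "set_integrable lborel ?I p" if "continuous_on UNIV p" for p :: "real \<Rightarrow> real"
      using that by (intro set_integrable_continuous) auto
    \<comment> \<open>In place of Cauchy-Schwarz, the bound |x| \<le> \<delta> + x^2 / \<delta>
      passes from first powers to squares; the two \<delta> integrate to \<open>2 * \<delta>\<close>
      because the interval has length 1. Letting n grow with \<delta> fixed, and only then \<delta>
      tend to 0, gives \<open>D = 0\<close>.\<close>
    have le: "\<bar>D\<bar> \<le> M * (2 * \<delta> + J n / \<delta>)" if \<delta>: "\<delta> > 0" for \<delta> n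
    proof -
      let ?a = "\<lambda>s. u s - \<Phi> n s" and ?b = "\<lambda>s. h s - deriv (\<Phi> n) s"
      \<comment> \<open>The test function contributes nothing to the pairing, so \<open>D\<close>
        may be computed with the differences, which are small in L2.\<close>
      have "(LINT s:?I|lborel. \<Phi> n s * \<psi>' s) = - (LINT s:?I|lborel. deriv (\<Phi> n) s * \<psi> s)"
      proof (rule integration_by_parts_vanishing)
        show "\<Phi> n 0 = 0" "\<Phi> n 1 = 0"
          using test[of n] closure_subset[of "{s. \<Phi> n s \<noteq> 0}"] by (force simp: test_function_def)+
      qed (use smooth smooth_imp_DERIV cont \<psi> \<psi>' in auto)
      moreover have "(LINT s:?I|lborel. \<Phi> n s * \<psi>' s + deriv (\<Phi> n) s * \<psi> s) =
          (LINT s:?I|lborel. \<Phi> n s * \<psi>' s) + (LINT s:?I|lborel. deriv (\<Phi> n) s * \<psi> s)"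
        by (intro set_integral_add mult cint cont \<psi>' cont_\<psi>)
      moreover have "(LINT s:?I|lborel. (u s * \<psi>' s + h s * \<psi> s) - (\<Phi> n s * \<psi>' s + deriv (\<Phi> n) s * \<psi> s)) =
          D - (LINT s:?I|lborel. \<Phi> n s * \<psi>' s + deriv (\<Phi> n) s * \<psi> s)"
        unfolding D_def by (intro set_integral_diff set_integral_add mult int cint cont \<psi>' cont_\<psi>)
      ultimately have D: "D = (LINT s:?I|lborel. ?a s * \<psi>' s + ?b s * \<psi> s)"
        by (simp add: algebra_simps)
      have int1: "set_integrable lborel ?I (\<lambda>s. ?a s * \<psi>' s + ?b s * \<psi> s)"
        by (intro set_integral_add mult set_integral_diff int cint cont \<psi>' cont_\<psi>)
      have int2: "set_integrable lborel ?I (\<lambda>s. M * (2 * \<delta> + ((?a s)\<^sup>2 + (?b s)\<^sup>2) / \<delta>))"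
        by (intro set_integrable_mult_right set_integral_add set_integrable_divide sqd cint continuous_intros)
      have "\<bar>D\<bar> \<le> (LINT s:?I|lborel. \<bar>?a s * \<psi>' s + ?b s * \<psi> s\<bar>)"
        unfolding D set_lebesgue_integral_def
        using integral_norm_bound[of lborel "\<lambda>s. indicator ?I s *\<^sub>R (?a s * \<psi>' s + ?b s * \<psi> s)"]
        by (simp add: abs_mult)
      also have "\<dots> \<le> (LINT s:?I|lborel. M * (2 * \<delta> + ((?a s)\<^sup>2 + (?b s)\<^sup>2) / \<delta>))"
      proof (rule set_integral_mono)
        fix s :: real assume "s \<in> ?I"
        then have s: "s \<in> {0..1}" by simp
        have young: "\<bar>x\<bar> \<le> \<delta> + x\<^sup>2 / \<delta>" for x
        proof -
          have "\<bar>x\<bar> * \<delta> \<le> \<delta>\<^sup>2 + x\<^sup>2"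
            using zero_le_power2[of "\<bar>x\<bar> - \<delta>"] zero_le_power2[of x] zero_le_power2[of \<delta>]
              mult_nonneg_nonneg[OF abs_ge_zero[of x] less_imp_le[OF \<delta>]]
            unfolding power2_diff power2_abs by linarith
          then show ?thesis using \<delta> by (simp add: field_simps power2_eq_square)
        qed
        have "\<bar>?a s * \<psi>' s + ?b s * \<psi> s\<bar> \<le> \<bar>?a s\<bar> * \<bar>\<psi>' s\<bar> + \<bar>?b s\<bar> * \<bar>\<psi> s\<bar>"
          unfolding abs_mult[symmetric] by (rule abs_triangle_ineq)
        also have "\<dots> \<le> \<bar>?a s\<bar> * M + \<bar>?b s\<bar> * M"
          using M[OF s] by (intro add_mono mult_left_mono) auto
        also have "\<dots> = M * (\<bar>?a s\<bar> + \<bar>?b s\<bar>)" by (simp add: algebra_simps)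
        also have "\<dots> \<le> M * ((\<delta> + (?a s)\<^sup>2 / \<delta>) + (\<delta> + (?b s)\<^sup>2 / \<delta>))"
          by (intro mult_left_mono add_mono young M0)
        finally show "\<bar>?a s * \<psi>' s + ?b s * \<psi> s\<bar> \<le> M * (2 * \<delta> + ((?a s)\<^sup>2 + (?b s)\<^sup>2) / \<delta>)"
          by (simp add: add_divide_distrib algebra_simps)
      qed (use int1 int2 in \<open>auto intro: set_integrable_abs\<close>)
      also have "\<dots> = M * (2 * \<delta> + J n / \<delta>)"
      proof -
        have "(LINT s:?I|lborel. 2 * \<delta> + ((?a s)\<^sup>2 + (?b s)\<^sup>2) / \<delta>) =
            (LINT s:?I|lborel. 2 * \<delta>) + (LINT s:?I|lborel. ((?a s)\<^sup>2 + (?b s)\<^sup>2) / \<delta>)"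
          by (intro set_integral_add set_integrable_divide sqd cint continuous_intros)
        then show ?thesis by (simp add: J_def set_integral_const)
      qed
      finally show ?thesis .
    qed
    have "\<bar>D\<bar> \<le> M * (2 * \<delta>)" if \<delta>: "\<delta> > 0" for \<delta>
    proof (rule tendsto_lowerbound)
      show "(\<lambda>n. M * (2 * \<delta> + J n / \<delta>)) \<longlonglongrightarrow> M * (2 * \<delta>)"
        using \<delta> by (auto intro!: tendsto_eq_intros J)
    qed (use le[OF \<delta>] in auto)
    moreover have "((\<lambda>\<delta>. M * (2 * \<delta>)) \<longlongrightarrow> 0) (at_right 0)"
      by (auto intro!: tendsto_eq_intros)
    ultimately have "\<bar>D\<bar> \<le> 0"
      by (intro tendsto_lowerbound[of _ _ "at_right 0"]) (auto simp: eventually_at_filter)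
    moreover have "D = (LINT s:?I|lborel. u s * \<psi>' s) + (LINT s:?I|lborel. h s * \<psi> s)"
      unfolding D_def by (intro set_integral_add mult int \<psi>' cont_\<psi>)
    ultimately show ?thesis by simp
  qed
  show ?thesis
    by (rule that[OF loc[unfolded u_def] int[unfolded u_def] sq[unfolded u_def] norm_eq[OF weak[unfolded u_def]] parts[unfolded u_def]])
qed

subsection \<open>The extension by zero\<close>

text \<open>The substitution t = \<epsilon> s. Agreement is asked for only on the open segment, so
  \<open>K\<close> is arbitrary at its two endpoints; this covers both the extension, defined with a
  closed segment, and its derivative, defined with an open one.\<close>

lemma
  fixes K F :: "real \<Rightarrow> real"
  assumes \<epsilon>: "0 < \<epsilon>"
    and out: "\<And>s. s \<notin> {0..1 / \<epsilon>} \<Longrightarrow> K s = 0"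
    and inn: "\<And>s. s \<in> {0<..<1 / \<epsilon>} \<Longrightarrow> K s = F (\<epsilon> * s)"
  shows set_integrable_rescale: "set_integrable lborel UNIV K \<longleftrightarrow> set_integrable lborel {0<..<1} F"
    and set_integral_rescale: "(LINT s:UNIV|lborel. K s) = (LINT t:{0<..<1}|lborel. F t) / \<epsilon>"
proof -
  let ?f = "\<lambda>s. indicator {0<..<1 / \<epsilon>} s *\<^sub>R K s"
  have *: "(\<lambda>t. ?f (0 + 1 / \<epsilon> * t)) = (\<lambda>t. indicator {0<..<1} t *\<^sub>R F t)"
    using \<epsilon> inn by (auto simp: indicator_def fun_eq_iff divide_simps)
  have K: "K = (\<lambda>s. indicator {0..1 / \<epsilon>} s *\<^sub>R K s)"
    using out by (auto simp: indicator_def fun_eq_iff)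
  have "set_integrable lborel UNIV K \<longleftrightarrow> set_integrable lborel {0..1 / \<epsilon>} K"
    unfolding set_integrable_def using K by simp
  also have "\<dots> \<longleftrightarrow> set_integrable lborel {0<..<1 / \<epsilon>} K"
    by (rule set_integrable_discrete_difference[of "{0, 1 / \<epsilon>}"]) auto
  also have "\<dots> \<longleftrightarrow> set_integrable lborel {0<..<1} F"
    using lborel_integrable_real_affine_iff[of "1 / \<epsilon>" ?f 0] \<epsilon> unfolding * set_integrable_def by simp
  finally show "set_integrable lborel UNIV K \<longleftrightarrow> set_integrable lborel {0<..<1} F" .
  have "(LINT s:UNIV|lborel. K s) = (LINT s:{0..1 / \<epsilon>}|lborel. K s)"
    unfolding set_lebesgue_integral_def using K by simp
  also have "\<dots> = (LINT s:{0<..<1 / \<epsilon>}|lborel. K s)"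
    by (rule set_integral_discrete_difference[of "{0, 1 / \<epsilon>}"]) auto
  also have "\<dots> = (LINT t:{0<..<1}|lborel. F t) / \<epsilon>"
    using lborel_integral_real_affine[of "1 / \<epsilon>" ?f 0] \<epsilon> unfolding * set_lebesgue_integral_def by simp
  finally show "(LINT s:UNIV|lborel. K s) = (LINT t:{0<..<1}|lborel. F t) / \<epsilon>" .
qed

theorem lemma4p1:
  shows "\<exists>k k' :: real. 0 < k \<and> 0 < k' \<and>
    (\<forall>(\<epsilon>::real) l v. 0 < \<epsilon> \<longrightarrow> \<epsilon> \<le> 1 \<longrightarrow> l = 1 / \<epsilon> \<longrightarrow> v \<in> H10_in \<longrightarrow>
       extend \<epsilon> v \<in> W_half l \<and>
       W_half_norm l (extend \<epsilon> v) \<le> k * H10_in_norm v \<and>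
       k * H10_in_norm v \<le> k' * W_half_norm l (extend \<epsilon> v))"
proof -
  \<comment> \<open>The squared densities are compared pointwise with the factor 4 in both
    directions; 2 would do, but 4 has a rational square root. So each norm is at most twice the
    other, giving k = 2, and k' = 2 * 2 because the middle term already carries k.\<close>
  have "extend \<epsilon> v \<in> W_half l \<and>
       W_half_norm l (extend \<epsilon> v) \<le> 2 * H10_in_norm v \<and>
       2 * H10_in_norm v \<le> 4 * W_half_norm l (extend \<epsilon> v)"
    if \<epsilon>: "0 < \<epsilon>" "\<epsilon> \<le> 1" and l: "l = 1 / \<epsilon>" and v: "v \<in> H10_in" for \<epsilon> l :: real and v
  proof -
    let ?I = "{0<..<1::real}"
    obtain h :: "real \<Rightarrow> real" where h:
      "locally_integrable ?I (\<lambda>s. v (0, s))" "locally_integrable ?I h"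
      "set_integrable lborel ?I (\<lambda>s. v (0, s))" "set_integrable lborel ?I h"
      "set_integrable lborel ?I (\<lambda>s. (v (0, s))\<^sup>2)" "set_integrable lborel ?I (\<lambda>s. (h s)\<^sup>2)"
      and norm_v: "H10_in_norm v = sqrt (LINT s:?I|lborel. (v (0, s))\<^sup>2 + (h s)\<^sup>2)"
      and parts: "\<And>\<psi> \<psi>'. (\<And>x. (\<psi> has_real_derivative \<psi>' x) (at x)) \<Longrightarrow> continuous_on UNIV \<psi>' \<Longrightarrow>
         (LINT s:?I|lborel. v (0, s) * \<psi>' s) = - (LINT s:?I|lborel. h s * \<psi> s)"
      using H10_in_weak_derivE[OF v] by blast
    have l1: "1 \<le> l" using \<epsilon> by (simp add: l)
    have \<epsilon>l: "\<epsilon> * l = 1" using \<epsilon> by (simp add: l)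
    define u where "u = (\<lambda>s. v (0, s))"
    define U where "U s = (if s \<in> {0..l} then u (\<epsilon> * s) else 0)" for s
    \<comment> \<open>The candidate weak derivative: the chain rule gives the factor \<epsilon>
      inside, and there is no contribution at the ends since no jump occurs.\<close>
    define H where "H s = (if s \<in> {0<..<l} then \<epsilon> * h (\<epsilon> * s) else 0)" for s
    have ext: "extend \<epsilon> v (quarter_arc l s) = U s" for s
      by (auto simp: extend_def quarter_arc_def U_def u_def l)
    \<comment> \<open>A tangential derivative is a function on the plane, so \<open>H\<close> is
      transported by the inverse of the parametrization.\<close>
    define G where "G x = H (snd x - (fst x - l))" for x
    have G: "G (quarter_arc l s) = H s" for s
      by (auto simp: G_def quarter_arc_def)
    define q where "q s = 1 + (norm (quarter_arc l s))\<^sup>2" for s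
    have q: "q s = 1 + l\<^sup>2 + s\<^sup>2" if "0 \<le> s" for s
      using that by (simp add: q_def quarter_arc_def norm_Pair)
    \<comment> \<open>This is 1 + |x|^2 in the rescaled variable t = \<epsilon> s, as s = l
      t.\<close>
    define p where "p t = 1 + l\<^sup>2 + (l * t)\<^sup>2" for t
    have p: "p t > 0" for t unfolding p_def by (simp add: add_pos_nonneg)
    have qp: "q s = p (\<epsilon> * s)" if "0 \<le> s" for s
      using q[OF that] \<epsilon>l by (simp add: p_def mult.assoc[symmetric] mult.commute)
    have p_cont: "continuous_on UNIV (\<lambda>t. p t powr c)" for c
      using p unfolding p_def by (intro continuous_intros) (auto simp: less_imp_neq[symmetric])

    have loc: "locally_integrable UNIV U" "locally_integrable UNIV H"
      using h \<epsilon> by (intro locally_integrableI;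
          subst set_integrable_rescale[OF \<epsilon>(1), of _ "\<lambda>t. v (0, t)"] set_integrable_rescale[OF \<epsilon>(1), of _ "\<lambda>t. \<epsilon> * h t"];
          auto simp: U_def H_def l u_def)+
    have weak: "weak_deriv UNIV (extend \<epsilon> v \<circ> quarter_arc l) (G \<circ> quarter_arc l)"
      unfolding weak_deriv_def o_def ext G
    proof (intro conjI allI impI)
      fix \<phi> assume "test_function UNIV \<phi>"
      then have "smooth \<phi>" by (simp add: test_function_def)
      then have \<phi>: "(\<phi> has_real_derivative deriv \<phi> x) (at x)" "continuous_on UNIV (deriv \<phi>)" for x
        using smooth_imp_DERIV smooth_deriv smooth_imp_continuous by auto
      have "(LINT s:UNIV|lborel. U s * deriv \<phi> s) = (LINT t:?I|lborel. u t * deriv \<phi> (l * t)) / \<epsilon>"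
        by (rule set_integral_rescale[OF \<epsilon>(1)]) (use \<epsilon> in \<open>auto simp: U_def l\<close>)
      also have "\<dots> = (LINT t:?I|lborel. u t * (l * deriv \<phi> (l * t)))"
        by (simp add: l mult.left_commute)
      \<comment> \<open>The factor l completes the derivative of \<open>\<phi> (l * t)\<close>. This
        function need not vanish at 0 and 1, so the zero boundary values of \<open>v\<close> are
        used exactly here.\<close>
      also have "\<dots> = - (LINT t:?I|lborel. h t * \<phi> (l * t))"
        unfolding u_def
      proof (rule parts)
        show "((\<lambda>t. \<phi> (l * t)) has_real_derivative l * deriv \<phi> (l * x)) (at x)" for x
          by (rule DERIV_cong, rule DERIV_chain2[OF \<phi>(1)]) (auto intro!: derivative_eq_intros)
        show "continuous_on UNIV (\<lambda>t. l * deriv \<phi> (l * t))"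
          by (intro continuous_intros continuous_on_compose2[OF \<phi>(2)]) auto
      qed
      also have "(LINT t:?I|lborel. h t * \<phi> (l * t)) = (LINT t:?I|lborel. \<epsilon> * h t * \<phi> (l * t)) / \<epsilon>"
        using \<epsilon> by (simp add: mult.assoc)
      also have "\<dots> = (LINT s:UNIV|lborel. H s * \<phi> s)"
        by (rule set_integral_rescale[OF \<epsilon>(1), symmetric]) (use \<epsilon> in \<open>auto simp: H_def l\<close>)
      finally show "(LINT s:UNIV|lborel. U s * deriv \<phi> s) = - (LINT s:UNIV|lborel. H s * \<phi> s)" .
    qed (use loc in auto)

    have w: "(\<lambda>s. (1 + (norm (quarter_arc l s))\<^sup>2) powr c) \<in> borel_measurable borel" for c
      using measurable_compose[OF quarter.measurable_\<gamma> borel_measurable_norm] by simp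
    have "set_integrable lborel ?I (\<lambda>t. (\<epsilon> * h t)\<^sup>2)"
      unfolding power_mult_distrib by (intro set_integrable_mult_right h)
    then have sq: "set_integrable lborel ?I (\<lambda>t. p t powr c * (u t)\<^sup>2)"
        "set_integrable lborel ?I (\<lambda>t. p t powr c * (\<epsilon> * h t)\<^sup>2)" for c
      using set_integrable_mult_continuous[OF h(5) p_cont] set_integrable_mult_continuous[OF _ p_cont]
      by (simp_all add: u_def mult.commute[of "p _ powr c"])
    have "set_integrable lborel UNIV (\<lambda>s. q s powr (- 1 / 2) * (U s)\<^sup>2)"
      by (rule set_integrable_rescale[OF \<epsilon>(1), THEN iffD2, OF _ _ sq(1)]) (auto simp: U_def l qp)
    moreover have "set_integrable lborel UNIV (\<lambda>s. q s powr (1 / 2) * (H s)\<^sup>2)"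
      by (rule set_integrable_rescale[OF \<epsilon>(1), THEN iffD2, OF _ _ sq(2)]) (auto simp: H_def l qp)
    ultimately have mem: "extend \<epsilon> v \<in> W_half l"
      unfolding W_half_def quarter.sobolev_space_iff[OF w w]
      using weak by (intro exI[of _ G]) (simp add: ext G q_def)

    let ?R = "\<lambda>t. p t powr (- 1 / 2) * (u t)\<^sup>2 + p t powr (1 / 2) * (\<epsilon> * h t)\<^sup>2"
    let ?N = "LINT t:?I|lborel. (u t)\<^sup>2 + (h t)\<^sup>2"
    have "W_half_norm l (extend \<epsilon> v) = sqrt (LINT s:UNIV|lborel. q s powr (- 1 / 2) * (U s)\<^sup>2 + q s powr (1 / 2) * (H s)\<^sup>2)"
      unfolding W_half_norm_def quarter.sobolev_norm_eq[OF w w weak] by (simp add: ext G q_def)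
    also have "(LINT s:UNIV|lborel. q s powr (- 1 / 2) * (U s)\<^sup>2 + q s powr (1 / 2) * (H s)\<^sup>2) = (LINT t:?I|lborel. ?R t) / \<epsilon>"
      by (rule set_integral_rescale[OF \<epsilon>(1)]) (use \<epsilon> in \<open>auto simp: H_def U_def l qp\<close>)
    also have "\<dots> = (LINT t:?I|lborel. l * ?R t)"
      by (simp add: l)
    finally have norm_W: "W_half_norm l (extend \<epsilon> v) = sqrt (LINT t:?I|lborel. l * ?R t)" .
    have int_R: "set_integrable lborel ?I (\<lambda>t. l * ?R t)"
      by (intro set_integrable_mult_right set_integral_add(1) sq)
    have int_N: "set_integrable lborel ?I (\<lambda>t. (u t)\<^sup>2 + (h t)\<^sup>2)"
      using h by (intro set_integral_add(1)) (simp_all add: u_def)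
    have bounds: "l * ?R t \<le> 4 * ((u t)\<^sup>2 + (h t)\<^sup>2)" "(u t)\<^sup>2 + (h t)\<^sup>2 \<le> 4 * (l * ?R t)" if t: "t \<in> ?I" for t
    proof -
      define r where "r = sqrt (p t)"
      \<comment> \<open>Here \<epsilon> \<le> 1 enters: for small l the summand 1 would dominate and
        \<open>r / l\<close> would be unbounded. Each of the three summands of \<open>p t\<close> is
        at most l^2, and their sum is rounded up to (2 l)^2.\<close>
      have "1 \<le> l\<^sup>2" using l1 by simp
      moreover have "(l * t)\<^sup>2 \<le> l\<^sup>2"
        using t l1 by (intro power_mono) (auto simp: mult_left_le)
      moreover have "0 \<le> (l * t)\<^sup>2" by simp
      moreover have "(2 * l)\<^sup>2 = 4 * l\<^sup>2" by (simp add: power_mult_distrib)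
      ultimately have "l\<^sup>2 \<le> p t" "p t \<le> (2 * l)\<^sup>2"
        unfolding p_def by linarith+
      then have r: "l \<le> r" "r \<le> 2 * l"
        using l1 unfolding r_def by (auto intro!: real_le_rsqrt real_le_lsqrt)
      have "p t powr (1 / 2) = r" "p t powr (- 1 / 2) = 1 / r"
        using p[of t] by (simp_all add: r_def powr_half_sqrt powr_minus_divide flip: minus_divide_left)
      \<comment> \<open>The factor l comes from arc length and \<epsilon>^2 from the squared
        derivative; together they leave 1 / l in the second term.\<close>
      then have R: "l * ?R t = (l / r) * (u t)\<^sup>2 + (r / l) * (h t)\<^sup>2"
        using \<epsilon> by (simp add: l power_mult_distrib field_simps power2_eq_square)
      have c: "1 / 2 \<le> l / r" "l / r \<le> 1" "1 \<le> r / l" "r / l \<le> 2"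
        using r l1 by (auto simp: divide_simps)
      have "l * ?R t \<le> 1 * (u t)\<^sup>2 + 2 * (h t)\<^sup>2"
        unfolding R using c by (intro add_mono mult_right_mono) auto
      then show "l * ?R t \<le> 4 * ((u t)\<^sup>2 + (h t)\<^sup>2)"
        using zero_le_power2[of "u t"] zero_le_power2[of "h t"] by argo
      have "(1 / 2) * (u t)\<^sup>2 + 1 * (h t)\<^sup>2 \<le> l * ?R t"
        unfolding R using c by (intro add_mono mult_right_mono) auto
      then show "(u t)\<^sup>2 + (h t)\<^sup>2 \<le> 4 * (l * ?R t)"
        using zero_le_power2[of "u t"] zero_le_power2[of "h t"] by argo
    qed
    have "(LINT t:?I|lborel. l * ?R t) \<le> (LINT t:?I|lborel. 4 * ((u t)\<^sup>2 + (h t)\<^sup>2))"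
      by (rule set_integral_mono[OF int_R set_integrable_mult_right[OF int_N]]) (rule bounds)
    then have 1: "(LINT t:?I|lborel. l * ?R t) \<le> 2\<^sup>2 * ?N"
      unfolding set_integral_mult_right by simp
    have "?N \<le> (LINT t:?I|lborel. 4 * (l * ?R t))"
      by (rule set_integral_mono[OF int_N set_integrable_mult_right[OF int_R]]) (rule bounds)
    then have 2: "?N \<le> 2\<^sup>2 * (LINT t:?I|lborel. l * ?R t)"
      unfolding set_integral_mult_right by simp
    have N: "H10_in_norm v = sqrt ?N" by (simp add: norm_v u_def)
    have "W_half_norm l (extend \<epsilon> v) \<le> 2 * H10_in_norm v"
      using real_sqrt_le_mono[OF 1] unfolding norm_W N by (simp add: real_sqrt_mult)
    moreover have "H10_in_norm v \<le> 2 * W_half_norm l (extend \<epsilon> v)"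
      using real_sqrt_le_mono[OF 2] unfolding norm_W N real_sqrt_mult by simp
    ultimately show ?thesis using mem by simp
  qed
  then show ?thesis
    by (intro exI[of _ 2] exI[of _ 4]) simp
qed

end
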